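(* Let $b,c,s\in\mathbb{R}$ and $a,\lambda>0$. Assume that $c<1+b^2/a$ and let $K = \{r\in\mathbb{R}\colon 1-a r^2-2br-c>0\}$. Then the solution of \[ \hat{r}= \operatorname*{arg\,max}_{r\in K} \left\{ \tfrac{1}{2}\log\left(1 - a r^2 - 2b r - c \right) - s r - \lambda |r| \right\} \] equals \[ \hat{r}=\begin{cases} 0 & \text{if } |\xi|\leq \lambda \text{ and } c<1,\\ -\frac{b}{a} & \text{else if } \zeta=0,\\ -\frac{\tilde{b}}{2\tilde{a}} +\operatorname{sign}(\tilde{a}) \sqrt{\left(\frac{\tilde{b}}{2\tilde{a}}\right)^2 - \frac{\tilde{c}}{\tilde{a}}} & \text{else}, \end{cases} \] where \[ \xi = \frac{-b}{1-c} - s, \qquad \zeta=s+\lambda_s,\qquad \lambda_s = \begin{cases} \operatorname{sign}(\xi)\lambda, & \text{if } c<1,\\ \operatorname{sign}(-b)\lambda, & \text{if } c\geq1,\end{cases} \] and \[ \tilde{a} = -\zeta a,\qquad \tilde{b} = a - 2\zeta b, \qquad \tilde{c} = \zeta(1-c) + b. \]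
   Context: $\operatorname{sign}(x)\in\{-1,0,1\}$ is the usual sign function. The quantity $\xi$ is only used when $c<1$. *)

theory Defs
  imports Complex_Main
begin

end

(* For positive q and q', ln q - ln q' \<le> q / q' - 1. Applied to the concave quadratic inside the
   logarithm, this turns the subgradient condition at a feasible point into strict maximality,
   so no calculus is needed. The point is 0 if the subdifferential of the objective at 0
   contains 0; otherwise it is a stationary point of the smooth function obtained by replacing
   lam * \<bar>r\<bar> by lam_s * r, and one checks that it has the sign of lam_s. *)
theory Submission
  imports Defs
begin

lemma is_arg_max_iff_eq:
  fixes f :: "'a \<Rightarrow> 'b :: linorder"
  assumes "P x" and "\<And>y. P y \<Longrightarrow> y \<noteq> x \<Longrightarrow> f y < f x"
  shows "is_arg_max f P y \<longleftrightarrow> y = x"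
  using assms unfolding is_arg_max_def by (metis less_asym)

text \<open>The logarithm inequality enters in its weak form. Strictness comes from the term
  \<open>- a * (y - x)\<^sup>2\<close> in the expansion of the quadratic around
  \<open>x\<close>.\<close>

lemma log_quadratic_less:
  fixes a b c x y :: real
  assumes "a > 0"
    and x: "1 - a * x\<^sup>2 - 2 * b * x - c > 0"
    and y: "1 - a * y\<^sup>2 - 2 * b * y - c > 0"
    and "y \<noteq> x"
  shows "1/2 * ln (1 - a * y\<^sup>2 - 2 * b * y - c)
    < 1/2 * ln (1 - a * x\<^sup>2 - 2 * b * x - c)
      + (- a * x - b) / (1 - a * x\<^sup>2 - 2 * b * x - c) * (y - x)"
proof -
  define q where "q = 1 - a * x\<^sup>2 - 2 * b * x - c"
  define p where "p = 1 - a * y\<^sup>2 - 2 * b * y - c"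
  have pos: "q > 0" "p > 0" using x y by (simp_all add: q_def p_def)
  have "ln p - ln q = ln (p / q)" using pos by (simp add: ln_div)
  also have "\<dots> \<le> p / q - 1" using pos by (intro ln_le_minus_one) simp
  also have "\<dots> = (p - q) / q" using pos by (simp add: field_simps)
  also have "p - q = 2 * ((- a * x - b) * (y - x)) - a * (y - x)\<^sup>2"
    by (simp add: p_def q_def power2_eq_square algebra_simps)
  also have "(2 * ((- a * x - b) * (y - x)) - a * (y - x)\<^sup>2) / q
      < 2 * ((- a * x - b) * (y - x)) / q"
    using assms(1,4) pos(1) by (intro divide_strict_right_mono) auto
  finally show ?thesis unfolding p_def [symmetric] q_def [symmetric] by (simp add: ac_simps)
qed

text \<open>Assumption \<open>sub\<close> says that the slope of the smooth part at \<open>x\<close>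
  is a subgradient of the penalty there. Added to the strict tangent bound, it makes every other
  feasible point worse.\<close>

lemma penalized_log_quadratic_arg_max_iff:
  fixes a b c s lam x r :: real
  assumes "a > 0" and x: "1 - a * x\<^sup>2 - 2 * b * x - c > 0"
    and sub: "\<And>y. ((- a * x - b) / (1 - a * x\<^sup>2 - 2 * b * x - c) - s) * (y - x)
                \<le> lam * \<bar>y\<bar> - lam * \<bar>x\<bar>"
  shows "is_arg_max (\<lambda>r. 1/2 * ln (1 - a * r\<^sup>2 - 2 * b * r - c) - s * r - lam * \<bar>r\<bar>)
           (\<lambda>r. 1 - a * r\<^sup>2 - 2 * b * r - c > 0) r \<longleftrightarrow> r = x"
proof (rule is_arg_max_iff_eq)
  fix y assume y: "1 - a * y\<^sup>2 - 2 * b * y - c > 0" "y \<noteq> x"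
  show "1/2 * ln (1 - a * y\<^sup>2 - 2 * b * y - c) - s * y - lam * \<bar>y\<bar>
      < 1/2 * ln (1 - a * x\<^sup>2 - 2 * b * x - c) - s * x - lam * \<bar>x\<bar>"
    using log_quadratic_less [OF assms(1,2) y] sub [of y]
    unfolding left_diff_distrib [of _ s] right_diff_distrib [of s] by linarith
qed (fact x)

text \<open>In the centred variable \<open>u = r + b / a\<close> the quadratic is \<open>D - a * u\<^sup>2\<close> with
  \<open>D = 1 - c + b\<^sup>2 / a\<close>. The stationarity equation \<open>\<zeta> * (D - a * u\<^sup>2) = - a * u\<close> has
  two roots, and the one with \<open>\<zeta> * u < 0\<close> is feasible.\<close>

lemma stationary_point:
  fixes a b c z :: real
  defines "a' \<equiv> - z * a" and "b' \<equiv> a - 2 * z * b" and "c' \<equiv> z * (1 - c) + b"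
  defines "x \<equiv> if z = 0 then - (b / a)
     else - (b' / (2 * a')) + sgn a' * sqrt ((b' / (2 * a'))\<^sup>2 - c' / a')"
  assumes "a > 0" and "c < 1 + b\<^sup>2 / a"
  shows "1 - a * x\<^sup>2 - 2 * b * x - c > 0"
    and "- a * x - b = z * (1 - a * x\<^sup>2 - 2 * b * x - c)"
proof -
  define D where "D = 1 - c + b\<^sup>2 / a"
  define u where "u = x + b / a"
  have "D > 0" using assms(6) by (simp add: D_def)
  have Q: "1 - a * x\<^sup>2 - 2 * b * x - c = D - a * u\<^sup>2"
    using \<open>a > 0\<close> by (simp add: D_def u_def power2_eq_square field_simps)
  have L: "- a * x - b = - a * u"
    using \<open>a > 0\<close> by (simp add: u_def field_simps)
  have "D - a * u\<^sup>2 > 0 \<and> - a * u = z * (D - a * u\<^sup>2)"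
  proof (cases "z = 0")
    case True
    then show ?thesis using \<open>D > 0\<close> by (simp add: u_def x_def)
  next
    case False
    \<comment> \<open>Division by \<open>- z * a\<close> turns stationarity into
      \<open>u\<^sup>2 - 2 * p * u - D / a = 0\<close>, with roots \<open>p + R\<close> and
      \<open>p - R\<close>.\<close>
    define p where "p = 1 / (2 * z)"
    define R where "R = sqrt (p\<^sup>2 + D / a)"
    have "D / a > 0" using \<open>D > 0\<close> \<open>a > 0\<close> by simp
    have R2: "R\<^sup>2 = p\<^sup>2 + D / a"
      using \<open>D / a > 0\<close> by (simp add: R_def)
    have "\<bar>p\<bar> < R"
      unfolding R_def using \<open>D / a > 0\<close> by (intro real_less_rsqrt) simp
    have half: "b' / (2 * a') = b / a - p"
      using False \<open>a > 0\<close> by (simp add: a'_def b'_def p_def field_simps)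
    have "(b / a - p)\<^sup>2 - c' / a' = p\<^sup>2 + D / a"
      using False \<open>a > 0\<close>
      by (simp add: a'_def c'_def p_def D_def power2_eq_square field_simps)
    moreover have "sgn a' = - sgn z"
      using \<open>a > 0\<close> by (simp add: a'_def sgn_mult)
    ultimately have u: "u = p - sgn z * R"
      using False by (simp add: u_def x_def half R_def)
    have "sgn z = sgn p" by (simp add: p_def sgn_divide sgn_mult)
    then have "p * u = \<bar>p\<bar> * (\<bar>p\<bar> - R)"
      by (simp add: u algebra_simps abs_sgn power2_eq_square)
    moreover have "\<bar>p\<bar> > 0" using False by (simp add: p_def)
    ultimately have "p * u < 0"
      using \<open>\<bar>p\<bar> < R\<close> by (simp add: mult_pos_neg)
    \<comment> \<open>The root equation rewrites the quadratic as \<open>- 2 * a * (p * u)\<close>: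
      feasibility is then the sign of \<open>p * u\<close>, and stationarity follows from
      \<open>2 * p * z = 1\<close>.\<close>
    have "(p - u)\<^sup>2 = R\<^sup>2"
      using False by (simp add: u power_mult_distrib sgn_if)
    then have "D / a = u\<^sup>2 - 2 * (p * u)"
      using R2 by (simp add: power2_eq_square algebra_simps)
    then have eq: "D - a * u\<^sup>2 = - 2 * a * (p * u)"
      using \<open>a > 0\<close> by (simp add: field_simps)
    have "- 2 * a * (p * u) > 0"
      using \<open>p * u < 0\<close> \<open>a > 0\<close> by (simp add: mult_pos_neg)
    moreover have "z * (- 2 * a * (p * u)) = - a * u"
      using False by (simp add: p_def)
    ultimately show ?thesis using eq by simp
  qed
  then show "1 - a * x\<^sup>2 - 2 * b * x - c > 0"
    and "- a * x - b = z * (1 - a * x\<^sup>2 - 2 * b * x - c)"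
    unfolding Q L by simp_all
qed

text \<open>The derivative of the logarithmic term is decreasing: it is compared here at \<open>0\<close> and \<open>x\<close>.\<close>

lemma stationary_point_sign:
  fixes a b c z x :: real
  assumes "a > 0" and "c < 1" and x: "1 - a * x\<^sup>2 - 2 * b * x - c > 0"
    and stat: "- a * x - b = z * (1 - a * x\<^sup>2 - 2 * b * x - c)"
  shows "(- b / (1 - c) - z) * x \<ge> 0"
proof -
  define q where "q = 1 - a * x\<^sup>2 - 2 * b * x - c"
  have q: "q > 0" "z = (- a * x - b) / q"
    using x stat by (simp_all add: q_def)
  have "(- b / (1 - c) - z) * x = x\<^sup>2 * (a * (1 - c) + a * b * x + 2 * b\<^sup>2) / ((1 - c) * q)"
  proof -
    have "(- b / (1 - c) - z) * x = (- b * q - (- a * x - b) * (1 - c)) * x / ((1 - c) * q)"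
      unfolding q(2) using q(1) \<open>c < 1\<close> by (subst diff_frac_eq) simp_all
    also have "(- b * q - (- a * x - b) * (1 - c)) * x
        = x\<^sup>2 * (a * (1 - c) + a * b * x + 2 * b\<^sup>2)"
      by (simp add: q_def power2_eq_square algebra_simps)
    finally show ?thesis .
  qed
  \<comment> \<open>Doubling completes a square and leaves only nonnegative summands.\<close>
  moreover have "2 * (a * (1 - c) + a * b * x + 2 * b\<^sup>2) = (a * x + 2 * b)\<^sup>2 + a * (1 - c) + a * q"
    by (simp add: q_def power2_eq_square algebra_simps)
  then have "a * (1 - c) + a * b * x + 2 * b\<^sup>2 \<ge> 0"
    using \<open>a > 0\<close> \<open>c < 1\<close> q(1)
    by (smt (verit) mult_pos_pos zero_le_power2)
  ultimately show ?thesis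
    using \<open>c < 1\<close> q(1) by simp
qed

theorem theorem5:
  fixes a b c s lam \<xi> \<zeta> lam_s a' b' c' :: real
    and K :: "real set"
    and r :: real
  assumes "a > 0" and "lam > 0"
    and "c < 1 + b\<^sup>2 / a"
    and "K = {r. 1 - a * r\<^sup>2 - 2 * b * r - c > 0}"
    and "\<xi> = (- b) / (1 - c) - s"
    and "lam_s = (if c < 1 then sgn \<xi> * lam else sgn (- b) * lam)"
    and "\<zeta> = s + lam_s"
    and "a' = - \<zeta> * a"
    and "b' = a - 2 * \<zeta> * b"
    and "c' = \<zeta> * (1 - c) + b"
  shows "is_arg_max (\<lambda>r. 1/2 * ln (1 - a * r\<^sup>2 - 2 * b * r - c) - s * r - lam * \<bar>r\<bar>) (\<lambda>r. r \<in> K) r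
    \<longleftrightarrow> r = (if \<bar>\<xi>\<bar> \<le> lam \<and> c < 1 then 0
             else if \<zeta> = 0 then - (b / a)
             else - (b' / (2 * a')) + sgn a' * sqrt ((b' / (2 * a'))\<^sup>2 - c' / a'))"
proof -
  define x where "x = (if \<zeta> = 0 then - (b / a)
     else - (b' / (2 * a')) + sgn a' * sqrt ((b' / (2 * a'))\<^sup>2 - c' / a'))"
  note stationary = stationary_point [OF assms(1,3), of \<zeta>,
    folded assms(8-10), folded x_def]
  show ?thesis
  proof (cases "\<bar>\<xi>\<bar> \<le> lam \<and> c < 1")
    case True
    \<comment> \<open>The smooth part has slope \<open>\<xi>\<close> at 0, so this is the
      subgradient condition there.\<close>
    then have "\<xi> * y \<le> lam * \<bar>y\<bar>" for y
      by (metis abs_ge_self abs_ge_zero abs_mult mult_right_mono order_trans)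
    then have "is_arg_max (\<lambda>r. 1/2 * ln (1 - a * r\<^sup>2 - 2 * b * r - c) - s * r - lam * \<bar>r\<bar>)
           (\<lambda>r. 1 - a * r\<^sup>2 - 2 * b * r - c > 0) r \<longleftrightarrow> r = 0"
      using True assms(1,5) by (intro penalized_log_quadratic_arg_max_iff) simp_all
    then show ?thesis using True assms(4) by simp
  next
    case False
    \<comment> \<open>Replacing the penalty by \<open>lam_s * r\<close> is legitimate at
      \<open>x\<close> only if \<open>x\<close> does not have the sign opposite to
      \<open>lam_s\<close>.\<close>
    have "lam_s * x \<ge> 0"
    proof (cases "c < 1")
      case True
      with False have "lam < \<bar>\<xi>\<bar>" by simp
      have "- b / (1 - c) - \<zeta> = \<xi> - sgn \<xi> * lam"
        using True assms(5-7) by simp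
      with stationary_point_sign [OF assms(1) True stationary]
      have "(\<xi> - sgn \<xi> * lam) * x \<ge> 0" by simp
      \<comment> \<open>As \<open>lam < \<bar>\<xi>\<bar>\<close>, shrinking \<open>\<xi>\<close> by
        \<open>lam\<close> keeps its sign.\<close>
      then have "sgn \<xi> * x \<ge> 0"
        using \<open>lam < \<bar>\<xi>\<bar>\<close> \<open>lam > 0\<close>
        by (auto simp: sgn_if zero_le_mult_iff split: if_splits)
      then have "lam * (sgn \<xi> * x) \<ge> 0"
        using \<open>lam > 0\<close> by (metis less_imp_le mult_nonneg_nonneg)
      then show ?thesis using True assms(6) by (simp add: ac_simps)
    next
      case False
      \<comment> \<open>For \<open>c \<ge> 1\<close> feasibility alone decides the sign: all of
        \<open>K\<close> lies strictly on the side of \<open>- b\<close>.\<close>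
      have "a * x\<^sup>2 \<ge> 0" using \<open>a > 0\<close> by simp
      with stationary(1) False have "b * x < 0" by linarith
      then have "sgn (- b) * x \<ge> 0"
        by (auto simp: sgn_if mult_less_0_iff)
      then have "lam * (sgn (- b) * x) \<ge> 0"
        using \<open>lam > 0\<close> by (metis less_imp_le mult_nonneg_nonneg)
      then show ?thesis using False assms(6) by (simp add: ac_simps)
    qed
    moreover have "\<bar>lam_s\<bar> = lam"
    proof -
      have "c < 1 \<Longrightarrow> \<xi> \<noteq> 0" using False \<open>lam > 0\<close> by auto
      \<comment> \<open>With \<open>b = 0\<close> the bound on \<open>c\<close> would read
        \<open>c < 1\<close>.\<close>
      moreover have "\<not> c < 1 \<Longrightarrow> b \<noteq> 0" using assms(3) by auto
      ultimately show ?thesis using \<open>lam > 0\<close> by (simp add: assms(6) abs_mult sgn_if)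
    qed
    ultimately have eq: "lam_s * x = lam * \<bar>x\<bar>"
      by (metis abs_mult abs_of_nonneg)
    \<comment> \<open>Subtracting \<open>eq\<close> shows that \<open>lam_s\<close> is a subgradient
      of the penalty at \<open>x\<close>.\<close>
    have le: "lam_s * y \<le> lam * \<bar>y\<bar>" for y
      using \<open>\<bar>lam_s\<bar> = lam\<close> by (metis abs_ge_self abs_mult)
    have "(- a * x - b) / (1 - a * x\<^sup>2 - 2 * b * x - c) - s = lam_s"
      using stationary assms(7) by simp
    then have "is_arg_max (\<lambda>r. 1/2 * ln (1 - a * r\<^sup>2 - 2 * b * r - c) - s * r - lam * \<bar>r\<bar>)
           (\<lambda>r. 1 - a * r\<^sup>2 - 2 * b * r - c > 0) r \<longleftrightarrow> r = x"
      using assms(1) stationary(1) le eq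
      by (intro penalized_log_quadratic_arg_max_iff) (simp_all add: right_diff_distrib)
    then show ?thesis
      unfolding x_def if_not_P [OF False] assms(4) by simp
  qed
qed

end
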